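(* Let $\alpha \in \mathbb{Z}$ be such that both $\alpha - 8$ and $\alpha + 8$ are squarefree. Let $f_\alpha(T) = T^4 - 6T^2 - \alpha T - 3 \in \mathbb{Z}[T]$. Then $f_\alpha$ is irreducible over $\mathbb{Q}$, and if $\theta$ is a root of $f_\alpha$ and $K_\alpha = \mathbb{Q}(\theta)$, then the ring of integers of $K_\alpha$ is $\mathbb{Z}[\theta]$; in particular $K_\alpha$ is a monogenic quartic field.
   Context: An integer $m$ is squarefree if $p^2 \nmid m$ for every prime $p$ (negative integers allowed). *)

theory Defs
  imports "HOL-Computational_Algebra.Computational_Algebra"
begin

text \<open>
  Number fields are modelled as subsets of an arbitrary ambient field of characteristic 0,
  which contains a unique copy of the rationals.
\<close>

definition is_subfield :: "'a :: field set \<Rightarrow> bool" where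
  "is_subfield S \<longleftrightarrow> 0 \<in> S \<and> 1 \<in> S \<and>
     (\<forall>x\<in>S. \<forall>y\<in>S. x + y \<in> S \<and> x * y \<in> S) \<and> (\<forall>x\<in>S. - x \<in> S \<and> inverse x \<in> S)"

text \<open>
  The field \<open>\<rat>(\<theta>)\<close>; the prime field \<open>\<rat>\<close> lies in every subfield.
\<close>

definition rat_adjoin :: "'a :: field_char_0 \<Rightarrow> 'a set" where
  "rat_adjoin \<theta> = is_subfield hull {\<theta>}"

text \<open>
  The ring \<open>\<int>[\<theta>]\<close>.
\<close>

definition int_adjoin :: "'a :: field_char_0 \<Rightarrow> 'a set" where
  "int_adjoin \<theta> = range (\<lambda>p :: int poly. poly (map_poly of_int p) \<theta>)"

definition ring_of_integers :: "'a :: field_char_0 set \<Rightarrow> 'a set" where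
  "ring_of_integers K = {x \<in> K. algebraic_int x}"

abbreviation rat_scale :: "rat \<Rightarrow> 'a :: field_char_0 \<Rightarrow> 'a" where
  "rat_scale q x \<equiv> of_rat q * x"

lemma vector_space_rat_scale: "vector_space (rat_scale :: rat \<Rightarrow> 'a :: field_char_0 \<Rightarrow> 'a)"
  by unfold_locales (simp_all add: algebra_simps of_rat_add of_rat_mult)

text \<open>
  The degree \<open>[K : \<rat>]\<close>, with value 0 if it is infinite.
\<close>

definition rat_degree :: "'a :: field_char_0 set \<Rightarrow> nat" where
  "rat_degree K = vector_space.dim rat_scale K"

definition quartic_field :: "'a :: field_char_0 set \<Rightarrow> bool" where
  "quartic_field K \<longleftrightarrow> is_subfield K \<and> rat_degree K = 4"

definition monogenic :: "'a :: field_char_0 set \<Rightarrow> bool" where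
  "monogenic K \<longleftrightarrow> (\<exists>\<gamma>. ring_of_integers K = int_adjoin \<gamma>)"

definition f_poly :: "int \<Rightarrow> int poly" where
  "f_poly \<alpha> = monom 1 4 - monom 6 2 - monom \<alpha> 1 - monom 3 0"

text \<open>
  The library's \<open>squarefree\<close> is stated with arbitrary square divisors; on the integers
  (including 0, which is not squarefree, and negative numbers) it is the condition on primes.
\<close>

lemma squarefree_int_iff: "squarefree (m :: int) \<longleftrightarrow> (\<forall>p. prime p \<longrightarrow> \<not> p\<^sup>2 dvd m)"
proof (cases "m = 0")
  case True
  have "prime (2 :: int)" by simp
  then have "\<exists>p :: int. prime p" by blast
  moreover have "\<not> squarefree (0 :: int)" by (auto simp: squarefree_def intro: exI[of _ 2])
  ultimately show ?thesis using True by simp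
next
  case False
  then show ?thesis by (rule squarefree_factorial_semiring)
qed

end

theory Submission
  imports Defs "HOL-Computational_Algebra.Field_as_Ring" "Jordan_Normal_Form.Char_Poly"
begin

text \<open>
  If an algebraic integer \<open>x\<close> satisfies \<open>S(\<theta>) x = R(\<theta>)\<close> with integer polynomials \<open>S\<close>, \<open>R\<close>,
  then clearing denominators in its monic equation shows that \<open>f\<close> divides \<open>R\<^sup>m + S V\<close> for
  some \<open>m\<close> and \<open>V\<close>. To see that \<open>\<int>[\<theta>]\<close> is integrally closed it suffices to show that
  \<open>p x = g(\<theta>)\<close> with \<open>degree g < 4\<close> forces \<open>p\<close> to divide \<open>g\<close>, for every prime \<open>p\<close>.
  Taking \<open>S = p\<close>, the polynomial \<open>g\<close> is nilpotent modulo \<open>(p, f)\<close>, which settles the primes at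
  which \<open>f\<close> is separable; since \<open>9 (\<alpha>\<^sup>2 - 64)\<close> lies in the ideal \<open>(f, f')\<close>, the others divide
  \<open>\<alpha> + 8\<close> or \<open>\<alpha> - 8\<close>, or equal \<open>3\<close> and divide \<open>\<alpha>\<close>. For those,
  \<open>f = (T - e)\<^sup>3 (T + 3 e) - (\<alpha> + 8 e) T\<close> with \<open>e = \<plusminus>1\<close>, or \<open>f \<equiv> T\<^sup>4\<close> modulo \<open>3\<close>.
  A counterexample \<open>g\<close> can then be multiplied by a power of \<open>T - c\<close>, where \<open>c\<close> is the multiple
  root, so that \<open>S = (T - c)\<^sup>k\<close> becomes possible with \<open>p\<close> not dividing \<open>R(c)\<close>. Evaluating at
  \<open>c\<close> gives \<open>p | f(c) | R(c)\<^sup>m\<close>, a contradiction.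
\<close>

section \<open>Integer polynomials modulo a prime and a monic polynomial\<close>

lemma monic_division:
  fixes f g :: "int poly"
  assumes "lead_coeff f = 1"
  obtains q r where "g = f * q + r" "r = 0 \<or> degree r < degree f"
proof -
  have "f \<noteq> 0" using assms by auto
  obtain q r where qr: "pseudo_divmod g f = (q, r)" by fastforce
  show thesis
    using pseudo_divmod[OF \<open>f \<noteq> 0\<close> qr] assms by (intro that[of q r]) auto
qed

text \<open>Replacing \<open>r\<close> by its remainder \<open>s\<close> modulo \<open>f\<close>
  keeps the divisibility; then \<open>h + [:p:] * s\<close> is a multiple of \<open>f\<close> of
  degree below that of \<open>f\<close>, so it vanishes.\<close>

lemma const_dvd_if_monic_dvd:
  fixes f h r :: "int poly"
  assumes f: "lead_coeff f = 1" and deg: "degree h < degree f" and dvd: "f dvd h + [:p:] * r"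
  shows "[:p:] dvd h"
proof -
  obtain q s where r: "r = f * q + s" and s: "s = 0 \<or> degree s < degree f"
    using monic_division[OF f] by metis
  have "degree (h + [:p:] * s) < degree f"
    using s deg by (intro degree_add_less) (auto intro: le_less_trans[OF degree_smult_le])
  moreover have "f dvd h + [:p:] * s"
  proof -
    have "h + [:p:] * s = (h + [:p:] * r) - f * ([:p:] * q)" by (simp add: r algebra_simps)
    thus ?thesis using dvd by (metis dvd_diff dvd_triv_left)
  qed
  ultimately have "h + [:p:] * s = 0"
    by (meson dvd_imp_degree_le not_less)
  hence "h = [:p:] * (- s)" by (simp add: eq_neg_iff_add_eq_0)
  thus ?thesis by (rule dvdI)
qed

lemma const_not_dvd_monic:
  fixes f :: "int poly"
  assumes "prime p" "lead_coeff f = 1"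
  shows "\<not> [:p:] dvd f"
  using assms by (metis const_poly_dvd_iff not_prime_unit)

lemma prime_elem_const_int_poly: "prime p \<Longrightarrow> prime_elem [:p :: int:]"
  by (simp add: prime_elem_const_poly_iff prime_imp_prime_elem del: prime_elem_iff_prime_abs)

text \<open>
  Differentiating \<open>g\<^sup>p \<equiv> f\<^sup>j q\<close> modulo \<open>p\<close> kills the left-hand side, so \<open>f\<close> divides \<open>j f' q\<close>,
  and \<open>j f'\<close> is invertible modulo \<open>(p, f)\<close>. Iterating up to \<open>j = p\<close> replaces the factorization
  of \<open>f\<close> over the field with \<open>p\<close> elements by a comparison of degrees.
\<close>

lemma power_dvd_mod_prime_Suc:
  fixes f g q r :: "int poly"
  assumes f: "lead_coeff f = 1" and p: "prime p" and D: "\<not> p dvd D"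
    and bezout: "A * f + B * pderiv f = [:D:]"
    and j: "0 < j" "j < nat p" and eq: "g ^ nat p = f ^ j * q + [:p:] * r"
  shows "\<exists>q r. g ^ nat p = f ^ Suc j * q + [:p:] * r"
proof -
  obtain i where i: "j = Suc i" using j by (cases j) auto
  have p0: "p > 0" using p by (simp add: prime_gt_0_int)
  let ?X = "Polynomial.smult (int j) (pderiv f * q) + f * pderiv q"
  have "pderiv (g ^ nat p) = [:p:] * (g ^ (nat p - 1) * pderiv g)"
    using p0 by (simp add: pderiv_power)
  moreover have "pderiv (g ^ nat p) = f ^ i * ?X + [:p:] * pderiv r"
    unfolding eq i
    by (simp add: pderiv_add pderiv_mult pderiv_power_Suc pderiv_smult pderiv_pCons algebra_simps
        del: of_nat_Suc power_Suc) (simp add: algebra_simps)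
  ultimately have "f ^ i * ?X = [:p:] * (g ^ (nat p - 1) * pderiv g - pderiv r)"
    by (simp add: algebra_simps smult_diff_right)
  hence "[:p:] dvd f ^ i * ?X" by (metis dvd_triv_left)
  moreover have "\<not> [:p:] dvd f ^ i"
    using f by (intro const_not_dvd_monic p) (simp add: lead_coeff_power)
  ultimately have "[:p:] dvd ?X"
    using prime_elem_dvd_mult_iff[OF prime_elem_const_int_poly[OF p]] by blast
  then obtain s where s: "?X = [:p:] * s" by blast
  have "\<not> p dvd int j"
    using j p0 by (metis int_nat_eq nat_int nat_less_iff not_less of_nat_0_less_iff order_less_imp_le zdvd_imp_le)
  hence "\<not> p dvd int j * D" using D p prime_dvd_mult_iff by blast
  hence "coprime p (int j * D)" using p prime_imp_coprime by blast
  then obtain a b where ab: "a * p + b * (int j * D) = 1"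
    by (metis bezout_int coprime_iff_gcd_eq_1)
  have Bf: "B * pderiv f = [:D:] - A * f" using bezout by (simp add: algebra_simps)
  \<comment> \<open>\<open>?X\<close> is divisible by \<open>p\<close>; multiplying it by
    \<open>B\<close> and replacing \<open>B * pderiv f\<close> by \<open>D - A * f\<close> makes
    \<open>j * D * q\<close> a multiple of \<open>f\<close> modulo \<open>p\<close>. The
    coefficients \<open>a\<close>, \<open>b\<close> then invert \<open>j * D\<close> modulo
    \<open>p\<close>.\<close>
  have "Polynomial.smult (int j * D) q = [:p:] * (B * s) + f * (Polynomial.smult (int j) (A * q) - B * pderiv q)"
  proof -
    have "B * ?X = Polynomial.smult (int j) (B * pderiv f * q) + f * (B * pderiv q)"
      by (simp add: algebra_simps)
    also have "\<dots> = Polynomial.smult (int j * D) q - Polynomial.smult (int j) (A * f * q) + f * (B * pderiv q)"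
      unfolding Bf by (simp add: algebra_simps smult_diff_right)
    finally show ?thesis unfolding s by (simp add: algebra_simps smult_diff_right)
  qed
  moreover have "q = Polynomial.smult (a * p) q + Polynomial.smult b (Polynomial.smult (int j * D) q)"
    by (metis ab smult_1_left smult_add_left smult_smult)
  ultimately have "q = Polynomial.smult (a * p) q + Polynomial.smult b ([:p:] * (B * s) + f * (Polynomial.smult (int j) (A * q) - B * pderiv q))"
    by simp
  hence q: "q = f * Polynomial.smult b (Polynomial.smult (int j) (A * q) - B * pderiv q) + [:p:] * (Polynomial.smult a q + Polynomial.smult b (B * s))"
    by (simp add: algebra_simps smult_add_right smult_diff_right)
  define u v where "u = Polynomial.smult b (Polynomial.smult (int j) (A * q) - B * pderiv q)"
    and "v = Polynomial.smult a q + Polynomial.smult b (B * s)"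
  have "q = f * u + [:p:] * v" using q unfolding u_def v_def .
  hence "g ^ nat p = f ^ Suc j * u + [:p:] * (f ^ j * v + r)"
    unfolding eq by (simp add: algebra_simps smult_add_right)
  thus ?thesis by blast
qed

text \<open>The iteration ends with \<open>f ^ p\<close> dividing \<open>g ^ p\<close> modulo
  \<open>p\<close>. Since \<open>g ^ p\<close> has smaller degree than the monic
  \<open>f ^ p\<close>, it is zero modulo \<open>p\<close>, and \<open>p\<close> stays prime as a
  constant polynomial.\<close>

lemma prime_dvd_if_dvd_power_prime:
  fixes f g V :: "int poly"
  assumes f: "lead_coeff f = 1" and p: "prime p" and D: "\<not> p dvd D"
    and bezout: "A * f + B * pderiv f = [:D:]"
    and deg: "degree g < degree f" and dvd: "f dvd g ^ nat p + [:p:] * V"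
  shows "[:p:] dvd g"
proof -
  have p0: "nat p > 0" using p by (simp add: prime_gt_0_int)
  have "\<exists>q r. g ^ nat p = f ^ Suc i * q + [:p:] * r" if "i < nat p" for i
    using that
  proof (induction i)
    case 0
    obtain q where "g ^ nat p + [:p:] * V = f * q" using dvd by blast
    hence "g ^ nat p = f ^ Suc 0 * q + [:p:] * (- V)" by (simp add: algebra_simps)
    thus ?case by blast
  next
    case (Suc i)
    then show ?case using power_dvd_mod_prime_Suc[OF f p D bezout, of "Suc i"] by auto
  qed
  from this[of "nat p - 1"] obtain q r where qr: "g ^ nat p = f ^ nat p * q + [:p:] * r"
    using p0 by auto
  have "[:p:] dvd g ^ nat p"
  proof (rule const_dvd_if_monic_dvd)
    show "lead_coeff (f ^ nat p) = 1" using f by (simp add: lead_coeff_power)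
    have "degree (g ^ nat p) \<le> degree g * nat p" by (rule degree_power_le)
    also have "\<dots> < degree f * nat p" using deg p0 by simp
    also have "\<dots> = degree (f ^ nat p)" using f by (metis degree_power_eq leading_coeff_0_iff mult.commute zero_neq_one)
    finally show "degree (g ^ nat p) < degree (f ^ nat p)" .
    have "g ^ nat p + [:p:] * (- r) = f ^ nat p * q" by (simp add: qr)
    thus "f ^ nat p dvd g ^ nat p + [:p:] * (- r)" by simp
  qed
  thus ?thesis using prime_elem_dvd_power[OF prime_elem_const_int_poly[OF p]] by blast
qed

text \<open>Exponents are first enlarged to powers of \<open>p\<close>, then peeled off one factor
  \<open>p\<close> at a time: the remainder \<open>s\<close> of \<open>g ^ (p ^ k)\<close> modulo
  \<open>f\<close> has small degree and \<open>s ^ p\<close> is zero modulo \<open>(p, f)\<close>,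
  so the previous lemma gives \<open>p\<close> dividing \<open>s\<close>.\<close>

lemma prime_dvd_if_nilpotent_mod:
  fixes f g V :: "int poly"
  assumes f: "lead_coeff f = 1" and p: "prime p" and D: "\<not> p dvd D"
    and bezout: "A * f + B * pderiv f = [:D:]"
    and deg: "degree g < degree f" and dvd: "f dvd g ^ m + [:p:] * V"
  shows "[:p:] dvd g"
proof -
  have p1: "nat p > 1" using prime_gt_1_int[OF p] by simp
  have frob: "[:p:] dvd g" if "f dvd g ^ (nat p ^ k) + [:p:] * W" for k W
    using that
  proof (induction k arbitrary: W)
    case 0
    then show ?case using const_dvd_if_monic_dvd[OF f deg] by simp
  next
    case (Suc k)
    obtain q s where s: "g ^ (nat p ^ k) = f * q + s" and deg_s: "s = 0 \<or> degree s < degree f"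
      using monic_division[OF f] by metis
    have ds: "degree s < degree f" using deg_s deg by auto
    have "f dvd g ^ (nat p ^ k) - s" using s by simp
    hence "f dvd (g ^ (nat p ^ k)) ^ nat p - s ^ nat p"
      by (metis dvd_mult2 power_diff_sumr2)
    hence "f dvd g ^ (nat p ^ Suc k) - s ^ nat p"
      by (simp add: power_mult[symmetric] mult.commute)
    with Suc.prems have "f dvd (g ^ (nat p ^ Suc k) + [:p:] * W) - (g ^ (nat p ^ Suc k) - s ^ nat p)"
      by (rule dvd_diff)
    hence "f dvd s ^ nat p + [:p:] * W" by (simp add: add.commute)
    hence "[:p:] dvd s" by (rule prime_dvd_if_dvd_power_prime[OF f p D bezout ds])
    then obtain t where "s = [:p:] * t" by blast
    hence "g ^ (nat p ^ k) + [:p:] * (- t) = f * q" using s by simp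
    thus ?case using Suc.IH[of "- t"] by simp
  qed
  have "m \<le> nat p ^ m" using p1 by (simp add: less_imp_le less_exp power_gt_expt)
  hence "g ^ (nat p ^ m) + [:p:] * (V * g ^ (nat p ^ m - m)) = (g ^ m + [:p:] * V) * g ^ (nat p ^ m - m)"
    by (simp add: algebra_simps flip: power_add)
  thus ?thesis using dvd by (intro frob[of m "V * g ^ (nat p ^ m - m)"]) simp
qed

text \<open>Synthetic division by \<open>T - c\<close> is repeated as long as the value at
  \<open>c\<close> is zero modulo \<open>p\<close>; each round lowers the degree. The bound on
  \<open>j\<close> later guarantees \<open>j < e\<close> for a root \<open>c\<close> of multiplicity
  \<open>e\<close>.\<close>

lemma split_linear_factors_mod_prime:
  fixes g :: "int poly"
  assumes "\<not> [:p:] dvd g"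
  shows "\<exists>j q s. j \<le> degree g \<and> g = [:-c, 1:] ^ j * q + [:p:] * s \<and> \<not> p dvd poly q c"
  using assms
proof (induction "degree g" arbitrary: g rule: less_induct)
  case less
  show ?case
  proof (cases "p dvd poly g c")
    case False
    thus ?thesis by (intro exI[of _ 0] exI[of _ g]) auto
  next
    case True
    then obtain k where k: "poly g c = p * k" by blast
    define h where "h = synthetic_div g c"
    have g: "g = [:-c, 1:] * h + [:p:] * [:k:]"
      using synthetic_div_correct'[of c g] k by (simp add: h_def mult.commute)
    have nd: "\<not> [:p:] dvd h"
    proof
      assume "[:p:] dvd h"
      hence "[:p:] dvd [:-c, 1:] * h + [:p:] * [:k:]" by (intro dvd_add dvd_mult dvd_triv_left)
      thus False using less.prems g by simp
    qed
    have "degree g \<noteq> 0"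
    proof
      assume "degree g = 0"
      hence "h = 0" by (simp add: h_def synthetic_div_eq_0_iff)
      thus False using nd by simp
    qed
    hence dh: "Suc (degree h) = degree g" by (simp add: h_def degree_synthetic_div)
    then obtain j q s where j: "j \<le> degree h" "h = [:-c, 1:] ^ j * q + [:p:] * s" "\<not> p dvd poly q c"
      using less.hyps[of h] nd by auto
    have "g = [:-c, 1:] * ([:-c, 1:] ^ j * q + [:p:] * s) + [:p:] * [:k:]"
      using g j(2) by simp
    also have "\<dots> = [:-c, 1:] ^ Suc j * q + [:p:] * ([:-c, 1:] * s + [:k:])"
      by (simp only: power_Suc distrib_left mult.assoc mult.left_commute add.assoc)
    finally have "g = [:-c, 1:] ^ Suc j * q + [:p:] * ([:-c, 1:] * s + [:k:])" .
    thus ?thesis using j dh by (intro exI[of _ "Suc j"] exI) auto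
  qed
qed

section \<open>Evaluation of integer and rational polynomials, and multiples of algebraic
  integers\<close>

interpretation of_rat_poly_hom: map_poly_comm_ring_hom "of_rat :: rat \<Rightarrow> 'a :: field_char_0" ..

abbreviation ipoly :: "int poly \<Rightarrow> 'a :: field_char_0 \<Rightarrow> 'a" where
  "ipoly p x \<equiv> poly (map_poly of_int p) x"

abbreviation rpoly :: "rat poly \<Rightarrow> 'a :: field_char_0 \<Rightarrow> 'a" where
  "rpoly p x \<equiv> poly (map_poly of_rat p) x"

lemma rpoly_of_int: "rpoly (map_poly of_int p) x = ipoly p x"
  by (simp add: map_poly_map_poly o_def)

lemma rpoly_hom:
  "rpoly (p + q) x = rpoly p x + rpoly q x"
  "rpoly (p * q) x = rpoly p x * rpoly q x"
  "rpoly (- p) x = - rpoly p x"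
  by (simp_all add: of_rat_poly_hom.hom_add of_rat_poly_hom.hom_mult of_rat_poly_hom.hom_uminus)

lemma ipoly_hom:
  "ipoly (p + q) x = ipoly p x + ipoly q x"
  "ipoly (p * q) x = ipoly p x * ipoly q x"
  "ipoly (p ^ n) x = ipoly p x ^ n"
  "ipoly (\<Sum>i\<in>I. h i) x = (\<Sum>i\<in>I. ipoly (h i) x)"
  "ipoly [:a:] x = of_int a"
  by (simp_all add: of_int_hom.map_poly_pCons_hom of_int_poly_hom.hom_add of_int_poly_hom.hom_mult of_int_poly_hom.hom_power
      of_int_poly_hom.hom_sum poly_sum)

lemma of_rat_in_subfield:
  assumes S: "is_subfield (S :: 'a :: field_char_0 set)"
  shows "of_rat a \<in> S"
proof -
  have nat: "of_nat n \<in> S" for n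
    using S by (induction n) (auto simp: is_subfield_def)
  have int: "of_int k \<in> S" for k
    using S nat by (cases k) (auto simp: is_subfield_def simp del: of_nat_Suc)
  obtain c d where "a = Rat.Fract c d" "d > 0" by (cases a) auto
  hence "of_rat a = of_int c * (inverse (of_int d) :: 'a)"
    by (simp add: of_rat_rat divide_inverse)
  thus ?thesis using S int by (simp add: is_subfield_def)
qed

lemma rpoly_in_subfield:
  assumes S: "is_subfield S" and "x \<in> S"
  shows "rpoly q x \<in> S"
proof (induction q)
  case 0
  then show ?case using S by (simp add: is_subfield_def)
next
  case (pCons a q)
  have "rpoly (pCons a q) x = of_rat a + x * rpoly q x"
    by (simp add: of_rat_hom.map_poly_pCons_hom)
  thus ?case using S assms(2) pCons.IH of_rat_in_subfield[OF S, of a] by (simp add: is_subfield_def)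
qed

lemma clear_denominators:
  fixes q :: "rat poly"
  shows "\<exists>N > 0. \<exists>g :: int poly. Polynomial.smult (of_int N) q = map_poly of_int g"
proof (induction q)
  case 0
  show ?case by (intro exI[of _ 1]) (auto intro: exI[of _ 0])
next
  case (pCons a q)
  then obtain N g where N: "N > 0" "Polynomial.smult (of_int N) q = map_poly of_int g" by blast
  obtain c d where cd: "a = Rat.Fract c d" "d > 0" by (cases a) auto
  have "of_int (N * d) * a = of_int (N * c)" using cd by (simp add: Fract_of_int_quotient)
  moreover have "Polynomial.smult (of_int (N * d)) q = map_poly of_int (Polynomial.smult d g)"
    using N(2) by (simp add: mult.commute[of N] of_int_hom.map_poly_hom_smult flip: smult_smult)
  ultimately have "Polynomial.smult (of_int (N * d)) (pCons a q) = map_poly of_int (pCons (N * c) (Polynomial.smult d g))"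
    by (simp add: of_int_hom.map_poly_pCons_hom)
  thus ?case using N(1) cd(2) by (intro exI[of _ "N * d"] conjI exI) auto
qed

lemma algebraic_int_of_int_mult:
  fixes x :: "'a :: field_char_0"
  assumes "algebraic_int x"
  shows "algebraic_int (of_int k * x)"
proof -
  obtain P :: "int poly" where P: "ipoly P x = 0" "lead_coeff P = 1"
    using assms by (auto simp: algebraic_int_altdef_ipoly)
  define m where "m = degree P"
  \<comment> \<open>Formally \<open>Q(T) = k^m P(T / k)\<close>, which is again monic and
    integral.\<close>
  define Q where "Q = (\<Sum>i\<le>m. monom (coeff P i * k ^ (m - i)) i)"
  have coeff_Q: "coeff Q i = (if i \<le> m then coeff P i * k ^ (m - i) else 0)" for i
    by (simp add: Q_def coeff_sum)
  have "degree Q \<le> m" by (intro degree_le) (simp add: coeff_Q)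
  moreover have "coeff Q m = 1" using P(2) by (simp add: coeff_Q m_def)
  ultimately have deg: "degree Q = m" by (metis le_degree order_antisym zero_neq_one)
  have "ipoly Q (of_int k * x) = (\<Sum>i\<le>m. of_int k ^ m * (of_int (coeff P i) * x ^ i))"
    unfolding poly_altdef
  proof (simp add: deg coeff_Q, intro sum.cong refl)
    fix i assume "i \<in> {..m}"
    hence "(of_int k :: 'a) ^ m = of_int k ^ (m - i) * of_int k ^ i" by (simp flip: power_add)
    thus "of_int (coeff P i) * of_int k ^ (m - i) * (of_int k * x) ^ i =
        (of_int k :: 'a) ^ m * (of_int (coeff P i) * x ^ i)"
      by (simp add: power_mult_distrib mult_ac)
  qed
  also have "\<dots> = of_int k ^ m * ipoly P x"
    by (simp add: poly_altdef m_def sum_distrib_left)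
  finally have "ipoly Q (of_int k * x) = 0" using P(1) by simp
  thus ?thesis using \<open>coeff Q m = 1\<close> deg unfolding algebraic_int_altdef_ipoly by blast
qed

lemma rpoly_eq_sum:
  assumes "degree q < n"
  shows "rpoly q x = (\<Sum>i<n. of_rat (coeff q i) * x ^ i)"
proof -
  have "rpoly q x = (\<Sum>i\<le>degree q. of_rat (coeff q i) * x ^ i)" by (simp add: poly_altdef)
  also have "\<dots> = (\<Sum>i<n. of_rat (coeff q i) * x ^ i)"
    using assms by (intro sum.mono_neutral_left) (auto simp: coeff_eq_0)
  finally show ?thesis .
qed

section \<open>The field generated by a root of a monic irreducible polynomial\<close>

locale primitive_element =
  fixes f :: "int poly" and \<theta> :: "'a :: field_char_0"
  assumes monic: "lead_coeff f = 1"
    and irreducible: "irreducible (map_poly of_int f :: rat poly)"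
    and root: "ipoly f \<theta> = 0"
begin

abbreviation f_rat :: "rat poly" where "f_rat \<equiv> map_poly of_int f"

text \<open>A Bezout identity between \<open>f\<close> and \<open>q\<close>, evaluated at \<theta>.
  It gives both the minimality of \<open>f\<close> and the inverses in the field.\<close>

lemma rational_bezout:
  fixes q :: "rat poly"
  assumes "\<not> f_rat dvd q"
  obtains b where "rpoly b \<theta> * rpoly q \<theta> = 1"
proof -
  have "coprime f_rat q"
    using irreducible assms by (intro prime_elem_imp_coprime irreducible_imp_prime_elem_gcd)
  then obtain a b where "a * f_rat + b * q = 1"
    using bezout_coefficients_fst_snd[of "f_rat" q] by (metis coprime_iff_gcd_eq_1)
  hence "rpoly (a * f_rat + b * q) \<theta> = 1" by simp
  thus thesis using that[of b] by (simp add: rpoly_hom rpoly_of_int root)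
qed

lemma rational_minimal:
  assumes "rpoly q \<theta> = 0"
  shows "f_rat dvd q"
  using rational_bezout[of q] assms by (metis mult_zero_right zero_neq_one)

lemma degree_pos: "degree f > 0"
proof (rule ccontr)
  assume "\<not> degree f > 0"
  hence "f = 1" using monic by (metis degree_eq_zeroE gr0I lead_coeff_pCons(2) one_pCons)
  thus False using irreducible by simp
qed

lemma rational_eq_0:
  assumes "rpoly q \<theta> = 0" "degree q < degree f"
  shows "q = 0"
  using rational_minimal[OF assms(1)] assms(2) by (metis dvd_imp_degree_le of_int_hom.degree_map_poly_hom not_less)

text \<open>As \<open>f\<close> is monic, division by it stays over the integers; minimality over
  the rationals kills the remainder.\<close>

lemma integer_minimal:
  assumes "ipoly Q \<theta> = 0"
  shows "f dvd Q"
proof -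
  obtain q r where q: "Q = f * q + r" and r: "r = 0 \<or> degree r < degree f"
    using monic_division[OF monic] by metis
  have "ipoly r \<theta> = 0" using assms root by (simp add: q ipoly_hom)
  hence "rpoly (map_poly of_int r) \<theta> = 0" by (simp add: rpoly_of_int)
  hence "r = 0" using r rational_eq_0[of "map_poly of_int r"] by (metis of_int_hom.degree_map_poly_hom of_int_poly_hom.hom_0_iff)
  thus ?thesis by (simp add: q)
qed

lemma algebraic_int_quotient:
  assumes x: "algebraic_int x" and eq: "ipoly S \<theta> * x = ipoly R \<theta>"
  shows "\<exists>m V. f dvd R ^ m + S * V"
proof -
  obtain P :: "int poly" where P: "ipoly P x = 0" "lead_coeff P = 1"
    using x by (auto simp: algebraic_int_altdef_ipoly)
  define m where "m = degree P"
  \<comment> \<open>In \<open>S^m P(R / S)\<close> every term below the leading one contains a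
    factor \<open>S\<close>; \<open>V\<close> is their sum with one \<open>S\<close>
    removed.\<close>
  define V where "V = (\<Sum>i<m. [:coeff P i:] * R ^ i * S ^ (m - Suc i))"
  have SV: "S * V = (\<Sum>i<m. [:coeff P i:] * R ^ i * S ^ (m - i))"
    unfolding V_def sum_distrib_left
    by (intro sum.cong refl) (simp add: Suc_diff_Suc[symmetric] mult_ac)
  have "R ^ m + S * V = (\<Sum>i\<le>m. [:coeff P i:] * R ^ i * S ^ (m - i))"
    using P(2) by (simp add: SV m_def lessThan_Suc_atMost[symmetric])
  hence "ipoly (R ^ m + S * V) \<theta> = (\<Sum>i\<le>m. of_int (coeff P i) * ipoly R \<theta> ^ i * ipoly S \<theta> ^ (m - i))"
    by (simp only: ipoly_hom)
  also have "\<dots> = (\<Sum>i\<le>m. ipoly S \<theta> ^ m * (of_int (coeff P i) * x ^ i))"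
  proof (intro sum.cong refl)
    fix i assume "i \<in> {..m}"
    hence "ipoly S \<theta> ^ m = ipoly S \<theta> ^ i * ipoly S \<theta> ^ (m - i)" by (simp flip: power_add)
    thus "of_int (coeff P i) * ipoly R \<theta> ^ i * ipoly S \<theta> ^ (m - i) = ipoly S \<theta> ^ m * (of_int (coeff P i) * x ^ i)"
      by (simp add: eq[symmetric] power_mult_distrib mult_ac)
  qed
  also have "\<dots> = ipoly S \<theta> ^ m * ipoly P x"
    by (simp add: poly_altdef m_def sum_distrib_left)
  finally show ?thesis using P(1) integer_minimal by auto
qed

lemma prime_dvd_unramified:
  assumes "prime p" "\<not> p dvd D" "A * f + B * pderiv f = [:D:]"
    and "algebraic_int x" "of_int p * x = ipoly g \<theta>" "degree g < degree f"
  shows "[:p:] dvd g"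
proof -
  obtain m V where "f dvd g ^ m + [:p:] * V"
    using algebraic_int_quotient[of x "[:p:]" g] assms by auto
  thus ?thesis using prime_dvd_if_nilpotent_mod[OF monic] assms by blast
qed

text \<open>Here \<open>c\<close> is a root of multiplicity at least \<open>e\<close> of
  \<open>f\<close> modulo \<open>p\<close>, with cofactor \<open>w\<close>, and the numerator of
  \<open>x\<close> is already known to be a multiple of \<open>w\<close> modulo
  \<open>p\<close>.\<close>

lemma prime_dvd_linear_factor:
  assumes p: "prime p" and x: "algebraic_int x" "of_int p * x = ipoly (w * h + [:p:] * s) \<theta>"
    and f: "f = [:-c, 1:] ^ e * w - [:p:] * r" and rc: "\<not> p dvd poly r c"
    and deg: "degree h < e"
  shows "[:p:] dvd h"
proof (rule ccontr)
  assume "\<not> [:p:] dvd h"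
  then obtain j q t where j: "j \<le> degree h" and h: "h = [:-c, 1:] ^ j * q + [:p:] * t"
    and qc: "\<not> p dvd poly q c"
    using split_linear_factors_mod_prime by metis
  define L where "L = [:-c, 1:]"
  define k where "k = e - j"
  have k: "k > 0" "e = k + j" using j deg by (auto simp: k_def)
  have p0: "p \<noteq> 0" using p by auto
  \<comment> \<open>The exponent \<open>k\<close> completes \<open>L ^ j\<close> to
    \<open>L ^ e\<close>, and \<open>L ^ e * w = f + [:p:] * r\<close>. At \<theta> the multiple of
    \<open>f\<close> vanishes and a factor \<open>p\<close> cancels, leaving
    \<open>R\<close>.\<close>
  define R where "R = r * q + L ^ k * (w * t + s)"
  have "L ^ k * (w * h + [:p:] * s) = L ^ e * w * q + [:p:] * (L ^ k * (w * t + s))"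
    unfolding h L_def[symmetric] k(2) power_add by (simp only: algebra_simps)
  also have "L ^ e * w = f + [:p:] * r" by (simp add: f L_def)
  finally have "L ^ k * (w * h + [:p:] * s) = f * q + [:p:] * R"
    unfolding R_def by (simp only: algebra_simps)
  from arg_cong[OF this, of "\<lambda>u. ipoly u \<theta>"]
  have "ipoly (L ^ k) \<theta> * (of_int p * x) = of_int p * ipoly R \<theta>"
    by (simp only: ipoly_hom(2) x(2)) (simp only: ipoly_hom root, simp)
  hence "ipoly (L ^ k) \<theta> * x = ipoly R \<theta>" using p0 by simp
  then obtain m V where "f dvd R ^ m + L ^ k * V"
    using algebraic_int_quotient[OF x(1)] by blast
  hence "poly f c dvd poly (R ^ m + L ^ k * V) c" by (metis dvdE dvd_triv_left poly_mult)
  \<comment> \<open>\<open>L\<close> vanishes at \<open>c\<close> and \<open>k > 0\<close>, so only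
    \<open>r * q\<close> survives.\<close>
  also have "poly (R ^ m + L ^ k * V) c = (poly r c * poly q c) ^ m"
    using k by (simp add: R_def L_def zero_power)
  finally have "poly f c dvd (poly r c * poly q c) ^ m" .
  moreover have "p dvd poly f c" using deg by (simp add: f zero_power)
  ultimately have "p dvd (poly r c * poly q c) ^ m" by (rule dvd_trans[rotated])
  thus False using p rc qc by (metis prime_dvd_mult_iff prime_dvd_power)
qed

lemma is_subfield_range_rpoly: "is_subfield (range (\<lambda>q. rpoly q \<theta>))"
  unfolding is_subfield_def
proof (intro conjI ballI)
  show "0 \<in> range (\<lambda>q. rpoly q \<theta>)" by (rule range_eqI[of _ _ 0]) simp
  show "1 \<in> range (\<lambda>q. rpoly q \<theta>)" by (rule range_eqI[of _ _ 1]) simp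
next
  fix x y assume "x \<in> range (\<lambda>q. rpoly q \<theta>)" "y \<in> range (\<lambda>q. rpoly q \<theta>)"
  then obtain a b where x: "x = rpoly a \<theta>" and y: "y = rpoly b \<theta>" by blast
  show "x + y \<in> range (\<lambda>q. rpoly q \<theta>)" by (rule range_eqI[of _ _ "a + b"]) (simp only: x y rpoly_hom)
  show "x * y \<in> range (\<lambda>q. rpoly q \<theta>)" by (rule range_eqI[of _ _ "a * b"]) (simp only: x y rpoly_hom)
next
  fix x assume "x \<in> range (\<lambda>q. rpoly q \<theta>)"
  then obtain a where x: "x = rpoly a \<theta>" by blast
  show "- x \<in> range (\<lambda>q. rpoly q \<theta>)" by (rule range_eqI[of _ _ "- a"]) (simp only: x rpoly_hom)
  show "inverse x \<in> range (\<lambda>q. rpoly q \<theta>)"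
  proof (cases "f_rat dvd a")
    case True
    hence "x = 0" by (auto simp: x dvd_def rpoly_hom rpoly_of_int root)
    thus ?thesis by (auto intro: range_eqI[of _ _ 0])
  next
    case False
    then obtain b where "rpoly b \<theta> * x = 1" using rational_bezout unfolding x by blast
    hence "inverse x = rpoly b \<theta>" by (metis inverse_unique mult.commute)
    thus ?thesis by blast
  qed
qed

lemma rat_adjoin_eq: "rat_adjoin \<theta> = range (\<lambda>q. rpoly q \<theta>)"
proof
  have "rpoly [:0, 1:] \<theta> = \<theta>" by (simp add: of_rat_hom.map_poly_pCons_hom)
  hence "\<theta> \<in> range (\<lambda>q. rpoly q \<theta>)" by (metis rangeI)
  thus "rat_adjoin \<theta> \<subseteq> range (\<lambda>q. rpoly q \<theta>)"
    unfolding rat_adjoin_def by (intro hull_minimal is_subfield_range_rpoly) auto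
  show "range (\<lambda>q. rpoly q \<theta>) \<subseteq> rat_adjoin \<theta>"
    unfolding rat_adjoin_def hull_def using rpoly_in_subfield by auto
qed

lemma is_subfield_rat_adjoin: "is_subfield (rat_adjoin \<theta>)"
  unfolding rat_adjoin_eq by (rule is_subfield_range_rpoly)

lemma reduced_rpoly:
  obtains r where "rpoly q \<theta> = rpoly r \<theta>" "degree r < degree f"
proof
  have "rpoly q \<theta> = rpoly (q div f_rat * f_rat + q mod f_rat) \<theta>" by (simp only: div_mult_mod_eq)
  also have "\<dots> = rpoly (q mod f_rat) \<theta>" by (simp only: rpoly_hom rpoly_of_int root) simp
  finally show "rpoly q \<theta> = rpoly (q mod f_rat) \<theta>" .
  have "degree f_rat = degree f" by simp
  thus "degree (q mod f_rat) < degree f"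
    using degree_mod_less'[of f_rat q] degree_pos irreducible by (cases "q mod f_rat = 0") auto
qed

lemma powers_independent:
  assumes "(\<Sum>i<degree f. of_rat (u i) * \<theta> ^ i) = 0" "i < degree f"
  shows "u i = 0"
proof -
  define q where "q = (\<Sum>i<degree f. monom (u i) i)"
  have coeff_q: "coeff q i = (if i < degree f then u i else 0)" for i
    by (simp add: q_def coeff_sum)
  have "degree q \<le> degree f - 1" by (intro degree_le) (auto simp: coeff_q)
  hence deg: "degree q < degree f" using degree_pos by linarith
  have "rpoly q \<theta> = 0" using assms(1) by (simp add: rpoly_eq_sum[OF deg] coeff_q)
  hence "q = 0" using deg by (rule rational_eq_0)
  thus ?thesis using coeff_q[of i] assms(2) by simp
qed

text \<open>The dimension is counted on a set of powers, so they must be distinct; a coincidence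
  would be a linear relation with coefficients 1 and -1.\<close>

lemma inj_on_powers: "inj_on (\<lambda>i. \<theta> ^ i) {..<degree f}"
proof (rule inj_onI, rule ccontr)
  fix i j assume ij: "i \<in> {..<degree f}" "j \<in> {..<degree f}" "\<theta> ^ i = \<theta> ^ j" "i \<noteq> j"
  define u :: "nat \<Rightarrow> rat" where "u = (\<lambda>k. if k = i then 1 else if k = j then -1 else 0)"
  have "(\<Sum>k<degree f. of_rat (u k) * \<theta> ^ k) =
      (\<Sum>k<degree f. (if k = i then \<theta> ^ i else 0) + (if k = j then - (\<theta> ^ j) else 0))"
    using ij(4) by (intro sum.cong) (auto simp: u_def)
  also have "\<dots> = 0" using ij by (simp add: sum.distrib)
  finally have "u i = 0" using ij(1) by (intro powers_independent) auto
  thus False by (simp add: u_def)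
qed

lemma rat_degree_rat_adjoin: "rat_degree (rat_adjoin \<theta>) = degree f"
proof -
  interpret V: vector_space "rat_scale :: rat \<Rightarrow> 'a \<Rightarrow> 'a" by (rule vector_space_rat_scale)
  define B where "B = (\<lambda>i. \<theta> ^ i) ` {..<degree f}"
  have "V.dim (rat_adjoin \<theta>) = degree f"
  proof (rule V.dim_unique)
    have "rpoly (monom 1 i) \<theta> = \<theta> ^ i" for i by (simp add: poly_monom)
    thus "B \<subseteq> rat_adjoin \<theta>" unfolding B_def rat_adjoin_eq by (metis image_subsetI rangeI)
    show "rat_adjoin \<theta> \<subseteq> V.span B"
    proof
      fix x assume "x \<in> rat_adjoin \<theta>"
      then obtain q where "x = rpoly q \<theta>" by (auto simp: rat_adjoin_eq)
      then obtain r where r: "x = rpoly r \<theta>" "degree r < degree f" using reduced_rpoly by metis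
      show "x \<in> V.span B"
        unfolding r(1) rpoly_eq_sum[OF r(2)]
        by (intro V.span_sum V.span_scale V.span_base) (auto simp: B_def)
    qed
    show "V.independent B"
    proof (rule V.independent_if_scalars_zero)
      show "finite B" by (simp add: B_def)
      fix u x assume sum: "(\<Sum>x\<in>B. rat_scale (u x) x) = 0" and "x \<in> B"
      then obtain i where i: "i < degree f" "x = \<theta> ^ i" by (auto simp: B_def)
      have "(\<Sum>i<degree f. of_rat (u (\<theta> ^ i)) * \<theta> ^ i) = 0"
        using sum unfolding B_def by (simp add: sum.reindex[OF inj_on_powers])
      thus "u x = 0" using powers_independent[of "\<lambda>i. u (\<theta> ^ i)"] i by simp
    qed
    show "card B = degree f" by (simp add: B_def card_image[OF inj_on_powers])
  qed
  thus ?thesis by (simp add: rat_degree_def)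
qed

section \<open>Integrality of polynomial values and descent on denominators\<close>

lemma reduced_ipoly:
  obtains r where "ipoly g \<theta> = ipoly r \<theta>" "degree r < degree f"
proof -
  obtain q r where g: "g = f * q + r" and r: "r = 0 \<or> degree r < degree f"
    using monic_division[OF monic] by metis
  have "ipoly g \<theta> = ipoly r \<theta>" by (simp add: g ipoly_hom root)
  thus thesis using r degree_pos by (intro that[of r]) auto
qed

text \<open>
  Multiplication by \<open>g(\<theta>)\<close> is given in the basis of powers of \<open>\<theta>\<close> by an integer matrix, whose
  characteristic polynomial is the required monic equation.
\<close>

lemma algebraic_int_ipoly: "algebraic_int (ipoly g \<theta>)"
proof -
  define n where "n = degree f"
  have "\<exists>r. ipoly (monom 1 i * g) \<theta> = ipoly r \<theta> \<and> degree r < n" for i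
    using reduced_ipoly n_def by metis
  then obtain r where r: "\<And>i. ipoly (monom 1 i * g) \<theta> = ipoly (r i) \<theta>" "\<And>i. degree (r i) < n"
    by metis
  define M where "M = mat n n (\<lambda>(i, j). coeff (r i) j)"
  define A :: "'a mat" where "A = map_mat of_int M"
  define v where "v = vec n (\<lambda>i. \<theta> ^ i)"
  have M: "M \<in> carrier_mat n n" and A: "A \<in> carrier_mat n n" by (simp_all add: M_def A_def)
  have ipoly_r: "(\<Sum>j = 0..<n. of_int (coeff (r i) j) * \<theta> ^ j) = ipoly g \<theta> * \<theta> ^ i" for i
  proof -
    have "ipoly (r i) \<theta> = (\<Sum>j\<le>degree (r i). of_int (coeff (r i) j) * \<theta> ^ j)"
      by (simp add: poly_altdef)
    also have "\<dots> = (\<Sum>j = 0..<n. of_int (coeff (r i) j) * \<theta> ^ j)"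
      using r(2)[of i] by (intro sum.mono_neutral_left) (auto simp: coeff_eq_0)
    finally show ?thesis using r(1)[of i] by (simp add: ipoly_hom poly_monom mult.commute)
  qed
  \<comment> \<open>The vector of powers is an eigenvector; it is nonzero because its entry of index
    0 is 1.\<close>
  have "A *\<^sub>v v = ipoly g \<theta> \<cdot>\<^sub>v v"
    by (rule eq_vecI) (simp_all add: A_def M_def v_def scalar_prod_def ipoly_r)
  moreover have "v \<noteq> 0\<^sub>v n"
  proof
    assume "v = 0\<^sub>v n"
    hence "v $ 0 = 0" using degree_pos by (simp add: n_def)
    thus False using degree_pos by (simp add: v_def n_def)
  qed
  ultimately have "eigenvalue A (ipoly g \<theta>)"
    unfolding eigenvalue_def eigenvector_def using A by (intro exI[of _ v]) (auto simp: v_def)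
  hence "poly (char_poly A) (ipoly g \<theta>) = 0" using eigenvalue_root_char_poly[OF A] by blast
  hence "ipoly (char_poly M) (ipoly g \<theta>) = 0" by (simp add: A_def of_int_hom.char_poly_hom[OF M])
  moreover have "lead_coeff (char_poly M) = 1" using degree_monic_char_poly[OF M] by metis
  ultimately show ?thesis unfolding algebraic_int_altdef_ipoly by blast
qed

lemma int_adjoin_subset_ring_of_integers: "int_adjoin \<theta> \<subseteq> ring_of_integers (rat_adjoin \<theta>)"
  unfolding int_adjoin_def ring_of_integers_def rat_adjoin_eq
  using algebraic_int_ipoly rpoly_of_int by (metis (mono_tags, lifting) image_subsetI mem_Collect_eq rangeI)

text \<open>Primes are removed from the denominator one by one: for \<open>N = p * M\<close> the
  hypothesis \<open>H\<close> applies to the algebraic integer \<open>M * x\<close>, and the factor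
  \<open>p\<close> cancels.\<close>

lemma in_int_adjoin_if_prime_dvd:
  assumes H: "\<And>p x g. \<lbrakk>prime p; algebraic_int x; of_int p * x = ipoly g \<theta>; degree g < degree f\<rbrakk> \<Longrightarrow> [:p:] dvd g"
    and x: "algebraic_int x"
  shows "\<lbrakk>N > 0; of_int N * x = ipoly g \<theta>; degree g < degree f\<rbrakk> \<Longrightarrow> x \<in> int_adjoin \<theta>"
proof (induction "nat N" arbitrary: N g rule: less_induct)
  case less
  show ?case
  proof (cases "N = 1")
    case True
    thus ?thesis using less.prems by (auto simp: int_adjoin_def)
  next
    case False
    then obtain p where p: "prime p" "p dvd N" using less.prems(1) prime_divisorE[of N] by auto
    then obtain M where N: "N = p * M" by blast
    have p1: "p > 1" using p(1) by (rule prime_gt_1_int)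
    have M: "0 < M" using less.prems(1) p1 by (simp add: N zero_less_mult_iff)
    have "of_int p * (of_int M * x) = ipoly g \<theta>" using less.prems(2) by (simp add: N mult.assoc)
    hence "[:p:] dvd g" by (rule H[OF p(1) algebraic_int_of_int_mult[OF x] _ less.prems(3)])
    then obtain h where g: "g = [:p:] * h" by blast
    have "of_int p * (of_int M * x) = of_int p * ipoly h \<theta>"
      using less.prems(2) by (simp only: N g ipoly_hom) (simp add: mult.assoc)
    hence "of_int M * x = ipoly h \<theta>" using p1 by simp
    moreover have "degree h < degree f" using less.prems(3) p1 by (simp add: g)
    moreover have "nat M < nat N" using p1 M by (simp add: N)
    ultimately show ?thesis using less.hyps M by blast
  qed
qed

lemma ring_of_integers_eq_int_adjoin:
  assumes "\<And>p x g. \<lbrakk>prime p; algebraic_int x; of_int p * x = ipoly g \<theta>; degree g < degree f\<rbrakk> \<Longrightarrow> [:p:] dvd g"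
  shows "ring_of_integers (rat_adjoin \<theta>) = int_adjoin \<theta>"
proof
  show "ring_of_integers (rat_adjoin \<theta>) \<subseteq> int_adjoin \<theta>"
  proof
    fix x assume "x \<in> ring_of_integers (rat_adjoin \<theta>)"
    then obtain q where x: "algebraic_int x" and q: "x = rpoly q \<theta>"
      by (auto simp: ring_of_integers_def rat_adjoin_eq)
    obtain N g where N: "N > 0" "Polynomial.smult (of_int N) q = map_poly of_int g"
      using clear_denominators by blast
    obtain r where r: "ipoly g \<theta> = ipoly r \<theta>" "degree r < degree f" using reduced_ipoly by blast
    have "of_int N * x = rpoly (Polynomial.smult (of_int N) q) \<theta>"
      by (simp add: q of_rat_hom.map_poly_hom_smult)
    also have "\<dots> = ipoly r \<theta>" by (simp only: N(2) rpoly_of_int r(1))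
    finally show "x \<in> int_adjoin \<theta>"
      using in_int_adjoin_if_prime_dvd[of x N r] assms x N(1) r(2) by blast
  qed
qed (rule int_adjoin_subset_ring_of_integers)

end

section \<open>Irreducibility of the quartic\<close>

lemma f_poly_eq: "f_poly \<alpha> = [:-3, -\<alpha>, -6, 0, 1:]"
  by (simp add: f_poly_def monom_altdef numeral_eq_Suc)

lemma rat_root_of_monic_is_int:
  fixes r :: rat
  assumes "ipoly P r = 0" "lead_coeff P = 1"
  obtains k where "r = of_int k"
proof -
  have "algebraic_int r" using assms by (auto simp: algebraic_int_altdef_ipoly)
  moreover have "r \<in> \<rat>" by (cases r) (auto simp: Fract_of_int_quotient)
  ultimately show thesis using rational_algebraic_int_is_int that by (auto simp: Ints_def)
qed

lemma int_dvd_3_cases: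
  fixes r :: int
  assumes "r dvd 3"
  shows "r \<in> {-3, -1, 1, 3}"
proof -
  have "\<bar>r\<bar> \<le> 3" using dvd_imp_le_int[OF _ assms] by simp
  hence "r \<in> {-3, -2, -1, 0, 1, 2, 3}" by auto
  thus ?thesis using assms by auto
qed

text \<open>A rational root is an integer dividing 3. The candidates 1 and -3 force
  \<open>\<alpha> = -8\<close>, while -1 and 3 force \<open>\<alpha> = 8\<close>.\<close>

lemma f_poly_no_rat_root:
  fixes r :: rat
  assumes "\<alpha> \<noteq> 8" "\<alpha> \<noteq> -8"
  shows "ipoly (f_poly \<alpha>) r \<noteq> 0"
proof
  assume 0: "ipoly (f_poly \<alpha>) r = 0"
  then obtain k where r: "r = of_int k"
    by (rule rat_root_of_monic_is_int) (simp add: f_poly_eq)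
  have "of_int (poly (f_poly \<alpha>) k) = (0 :: rat)"
    using 0 by (simp add: r of_int_hom.poly_map_poly)
  hence "poly (f_poly \<alpha>) k = 0" by (simp only: of_int_eq_0_iff)
  hence eq: "k * (k ^ 3 - 6 * k - \<alpha>) = 3"
    by (simp add: f_poly_eq algebra_simps power3_eq_cube)
  hence "k dvd 3" by (metis dvd_triv_left)
  thus False using int_dvd_3_cases[of k] eq assms by auto
qed

text \<open>The equations compare coefficients in
  \<open>f = (T^2 + x T + y) (T^2 - x T + d)\<close>. All three unknowns turn out to be integers,
  which leaves finitely many cases.\<close>

lemma f_poly_no_quadratic_factorization:
  fixes x y d :: rat
  assumes \<alpha>: "\<alpha> \<noteq> 8" "\<alpha> \<noteq> -8"
    and eqs: "y + d - x\<^sup>2 = -6" "x * (d - y) = - of_int \<alpha>" "y * d = -3"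
  shows False
proof -
  have "x\<^sup>2 * (d - y)\<^sup>2 = (of_int \<alpha>)\<^sup>2"
    using eqs(2) by (metis power2_minus power_mult_distrib)
  moreover have "(d - y)\<^sup>2 = (x\<^sup>2 - 6)\<^sup>2 + 12"
  proof -
    have "(d - y)\<^sup>2 = (y + d)\<^sup>2 - 4 * (y * d)" by (simp add: power2_eq_square algebra_simps)
    moreover have "y + d = x\<^sup>2 - 6" using eqs(1) by simp
    ultimately show ?thesis using eqs(3) by simp
  qed
  ultimately have "x\<^sup>2 * ((x\<^sup>2 - 6)\<^sup>2 + 12) = (of_int \<alpha>)\<^sup>2" by simp
  \<comment> \<open>the resolvent cubic, evaluated at \<open>x\<^sup>2\<close>\<close>
  hence "ipoly [:-\<alpha>\<^sup>2, 0, 48, 0, -12, 0, 1:] x = 0"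
    by (simp add: of_int_hom.map_poly_pCons_hom algebra_simps power2_eq_square)
  then obtain a where a: "x = of_int a" by (rule rat_root_of_monic_is_int) simp
  have d: "d = x\<^sup>2 - 6 - y" using eqs(1) by simp
  have "y * (x\<^sup>2 - 6 - y) = -3" using eqs(3) d by simp
  hence "ipoly [:-3, 6 - a\<^sup>2, 1:] y = 0"
    by (simp add: of_int_hom.map_poly_pCons_hom a algebra_simps power2_eq_square)
  then obtain b where b: "y = of_int b" by (rule rat_root_of_monic_is_int) simp
  define c where "c = a\<^sup>2 - 6 - b"
  have c: "d = of_int c" using d by (simp add: a b c_def)
  have "of_int (b * c) = (of_int (-3) :: rat)" using eqs(3) by (simp add: b c)
  hence bc: "b * c = -3" by (simp only: of_int_eq_iff)
  have "of_int (a * (c - b)) = (of_int (-\<alpha>) :: rat)" using eqs(2) by (simp add: a b c)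
  hence ac: "a * (c - b) = -\<alpha>" by (simp only: of_int_eq_iff)
  have a2: "a\<^sup>2 = c + b + 6" by (simp add: c_def)
  \<comment> \<open>From \<open>b * c = -3\<close> the sum \<open>b + c\<close> is 2 or -2, so the
    square of \<open>a\<close> is 8 or 4. The first is no square; in the second \<open>a\<close> is
    2 or -2 and \<open>c - b\<close> is 4 or -4, so \<alpha> is 8 or -8.\<close>
  have "a\<^sup>2 \<noteq> 8"
  proof
    assume 8: "a\<^sup>2 = 8"
    have "\<bar>a\<bar> \<le> 2 \<or> \<bar>a\<bar> \<ge> 3" by linarith
    thus False
    proof
      assume "\<bar>a\<bar> \<le> 2"
      hence "a\<^sup>2 \<le> 2\<^sup>2" by (metis abs_ge_zero power2_abs power_mono)
      thus False using 8 by simp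
    next
      assume "\<bar>a\<bar> \<ge> 3"
      hence "3\<^sup>2 \<le> a\<^sup>2" by (metis power2_abs power_mono zero_le_numeral)
      thus False using 8 by simp
    qed
  qed
  moreover have "a = 2 \<or> a = -2" if "a\<^sup>2 = 4"
    using that power2_eq_iff[of a 2] by simp
  moreover have "b dvd 3" using bc by (metis dvd_minus_iff dvd_triv_left)
  ultimately show False using int_dvd_3_cases[of b] bc ac a2 \<alpha> by auto
qed

lemma degree_1_root:
  fixes a :: "rat poly"
  assumes "degree a = 1"
  shows "\<exists>r. poly a r = 0"
proof -
  obtain u v where "a = [:u, v:]" "v \<noteq> 0" using degree1_coeffs[OF assms] by metis
  thus ?thesis by (intro exI[of _ "- u / v"]) (simp add: field_simps)
qed

lemma irreducible_f_poly:
  assumes \<alpha>: "\<alpha> \<noteq> 8" "\<alpha> \<noteq> -8"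
  shows "irreducible (map_poly of_int (f_poly \<alpha>) :: rat poly)"
proof -
  define F :: "rat poly" where "F = map_poly of_int (f_poly \<alpha>)"
  have F: "F = [:-3, - of_int \<alpha>, -6, 0, 1:]"
    by (simp add: F_def f_poly_eq of_int_hom.map_poly_pCons_hom)
  have deg_F: "degree F = 4" by (simp add: F)
  have no_root: "poly F r \<noteq> 0" for r
    using f_poly_no_rat_root[OF \<alpha>] by (simp add: F_def)
  show ?thesis unfolding F_def[symmetric]
  proof (rule irreducibleI)
    show "F \<noteq> 0" by (simp add: F)
    show "\<not> F dvd 1" using deg_F by (auto simp: poly_dvd_1)
    fix a b assume ab: "F = a * b"
    have nz: "a \<noteq> 0" "b \<noteq> 0" using ab \<open>F \<noteq> 0\<close> by auto
    have deg: "degree a + degree b = 4" using deg_F ab nz by (simp add: degree_mult_eq)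
    have "degree a \<noteq> 1" "degree b \<noteq> 1"
      using degree_1_root[of a] degree_1_root[of b] no_root by (auto simp: ab)
    moreover have "degree a \<noteq> 2"
    proof
      assume da: "degree a = 2"
      hence db: "degree b = 2" using deg by simp
      obtain a0 a1 a2 where a: "a = [:a0, a1, a2:]" "a2 \<noteq> 0" using degree2_coeffs[OF da] by blast
      obtain b0 b1 b2 where b: "b = [:b0, b1, b2:]" "b2 \<noteq> 0" using degree2_coeffs[OF db] by blast
      have eqs: "a0 * b0 = -3" "a0 * b1 + a1 * b0 = - of_int \<alpha>" "a0 * b2 + (a1 * b1 + a2 * b0) = -6"
        "a1 * b2 + a2 * b1 = 0" "a2 * b2 = 1"
        using ab unfolding F a b by (simp_all add: algebra_simps)
      have x: "a1 * b2 = - (a2 * b1)" using eqs(4) by (simp add: eq_neg_iff_add_eq_0)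
      \<comment> \<open>Since \<open>a2 * b2 = 1\<close>, multiplying the first factor by
        \<open>b2\<close> and the second by \<open>a2\<close> makes both monic; this gives
        \<open>x = a1 * b2\<close>, \<open>y = a0 * b2\<close>, \<open>d = a2 * b0\<close>.\<close>
      show False
      proof (rule f_poly_no_quadratic_factorization[OF \<alpha>])
        have "(a1 * b2)\<^sup>2 = a1 * b2 * - (a2 * b1)" by (simp only: power2_eq_square x)
        also have "\<dots> = - (a1 * b1) * (a2 * b2)" by (simp add: mult_ac)
        finally have "(a1 * b2)\<^sup>2 = - (a1 * b1)" by (simp add: eqs(5))
        thus "a0 * b2 + a2 * b0 - (a1 * b2)\<^sup>2 = -6" using eqs(3) by simp
        have "a1 * b2 * (a2 * b0 - a0 * b2) = a1 * b0 * (a2 * b2) - (a1 * b2) * (a0 * b2)"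
          by (simp add: algebra_simps)
        also have "\<dots> = a1 * b0 * (a2 * b2) + a0 * b1 * (a2 * b2)" by (simp add: x)
        finally show "a1 * b2 * (a2 * b0 - a0 * b2) = - of_int \<alpha>" using eqs(2,5) by simp
        have "a0 * b2 * (a2 * b0) = a0 * b0 * (a2 * b2)" by simp
        thus "a0 * b2 * (a2 * b0) = -3" by (simp only: eqs(1,5))
      qed
    qed
    ultimately have "degree a = 0 \<or> degree b = 0" using deg by linarith
    thus "a dvd 1 \<or> b dvd 1" using nz by (auto simp: is_unit_iff_degree)
  qed
qed

section \<open>Divisibility at each prime and the ring of integers\<close>

text \<open>Elimination gives \<open>(16 T - 4 \<alpha>) f + (12 + \<alpha> T - 4 T^2) f' = 3
  (\<alpha>^2 - 64) T\<close>. Multiplying by \<open>T^3 - 6 T - \<alpha>\<close> and using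
  \<open>T (T^3 - 6 T - \<alpha>) = f + 3\<close> leaves the constant. It has the same prime
  divisors as the discriminant \<open>-27 (\<alpha>^2 - 64)^2\<close>.\<close>

lemma f_poly_bezout:
  "([:-4 * \<alpha>, 16:] * [:-\<alpha>, -6, 0, 1:] - [:3 * (\<alpha>\<^sup>2 - 64):]) * f_poly \<alpha> +
   ([:12, \<alpha>, -4:] * [:-\<alpha>, -6, 0, 1:]) * pderiv (f_poly \<alpha>) = [:9 * (\<alpha>\<^sup>2 - 64):]"
  by (simp add: f_poly_eq pderiv_pCons algebra_simps power2_eq_square)

lemma f_poly_expansion:
  assumes "e\<^sup>2 = 1"
  shows "f_poly \<alpha> = [:-e, 1:] ^ 3 * [:3 * e, 1:] - [:0, \<alpha> + 8 * e:]"
proof -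
  have "e = 1 \<or> e = -1" using assms by (simp add: power2_eq_1_iff)
  thus ?thesis by (auto simp: f_poly_eq power3_eq_cube)
qed

text \<open>The Eisenstein case at 3, written in the shape of \<open>prime_dvd_linear_factor\<close>
  with \<open>c = 0\<close> and \<open>w = 1\<close>; the last factor has value 1 at 0.\<close>

lemma f_poly_expansion_0: "f_poly (3 * a) = [:-0, 1:] ^ 4 * 1 - [:3:] * [:1, a, 2:]"
  by (simp add: f_poly_eq numeral_eq_Suc)

lemma squarefree_prime_cofactor:
  fixes n :: int
  assumes "squarefree n" "prime p" "n = p * u"
  shows "\<not> p dvd u"
  using assms by (auto simp: squarefree_int_iff power2_eq_square)

text \<open>The root \<open>-3 e\<close> of \<open>f\<close> modulo \<open>p\<close> is treated
  first: nilpotency of \<open>g\<close> makes \<open>g\<close> vanish there modulo \<open>p\<close>,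
  so \<open>T + 3 e\<close> splits off. The quotient has degree below 3, which suits the triple root
  \<open>e\<close>. Squarefreeness enters as \<open>p\<close> not dividing \<open>u\<close>. For
  \<open>p = 2\<close> both roots coincide modulo \<open>p\<close>, and the argument covers this
  too.\<close>

lemma f_poly_prime_dvd_at_triple_root:
  assumes gen: "primitive_element (f_poly \<alpha>) \<theta>"
    and e: "e\<^sup>2 = 1" and sf: "squarefree (\<alpha> + 8 * e)"
    and p: "prime p" "p dvd \<alpha> + 8 * e"
    and x: "algebraic_int x" "of_int p * x = ipoly g \<theta>" and deg: "degree g < 4"
  shows "[:p:] dvd g"
proof -
  interpret primitive_element "f_poly \<alpha>" \<theta> by (rule gen)
  obtain u where u: "\<alpha> + 8 * e = p * u" using p(2) by blast
  have pu: "\<not> p dvd u" using squarefree_prime_cofactor[OF sf p(1) u] .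
  have pe: "\<not> p dvd e"
  proof
    assume "p dvd e"
    hence "p dvd e\<^sup>2" by (simp add: power2_eq_square)
    thus False using e p(1) not_prime_unit by auto
  qed
  have f: "f_poly \<alpha> = [:-e, 1:] ^ 3 * [:3 * e, 1:] - [:p:] * [:0, u:]"
    using f_poly_expansion[OF e, of \<alpha>] u by simp
  obtain m V where "f_poly \<alpha> dvd g ^ m + [:p:] * V"
    using algebraic_int_quotient[of x "[:p:]" g] x by (auto simp: ipoly_hom)
  hence "poly (f_poly \<alpha>) (- 3 * e) dvd poly (g ^ m + [:p:] * V) (- 3 * e)"
    by (metis dvdE dvd_triv_left poly_mult)
  moreover have "p dvd poly (f_poly \<alpha>) (- 3 * e)" unfolding f by simp
  ultimately have "p dvd poly (g ^ m + [:p:] * V) (- 3 * e)" by (rule dvd_trans[rotated])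
  hence "p dvd poly g (- 3 * e) ^ m" by (simp add: dvd_add_left_iff)
  hence "p dvd poly g (- 3 * e)" using p(1) prime_dvd_power by blast
  then obtain k where k: "poly g (- 3 * e) = p * k" by blast
  define h where "h = synthetic_div g (- 3 * e)"
  have g: "g = [:3 * e, 1:] * h + [:p:] * [:k:]"
    using synthetic_div_correct'[of "- 3 * e" g] k by (simp add: h_def mult.commute)
  have "[:p:] dvd h"
  proof (rule prime_dvd_linear_factor[OF p(1) x(1) _ f])
    show "of_int p * x = ipoly ([:3 * e, 1:] * h + [:p:] * [:k:]) \<theta>" using x(2) g by simp
    show "\<not> p dvd poly [:0, u:] e" using pu pe p(1) by (simp add: prime_dvd_mult_iff)
    show "degree h < 3" using deg by (simp add: h_def degree_synthetic_div)
  qed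
  hence "[:p:] dvd [:3 * e, 1:] * h + [:p:] * [:k:]" by (intro dvd_add dvd_mult dvd_triv_left)
  thus ?thesis using g by simp
qed

lemma f_poly_prime_dvd:
  assumes gen: "primitive_element (f_poly \<alpha>) \<theta>"
    and sf: "squarefree (\<alpha> - 8)" "squarefree (\<alpha> + 8)"
    and p: "prime p" and x: "algebraic_int x" "of_int p * x = ipoly g \<theta>" and deg: "degree g < 4"
  shows "[:p:] dvd g"
proof -
  interpret primitive_element "f_poly \<alpha>" \<theta> by (rule gen)
  have deg_f: "degree (f_poly \<alpha>) = 4" by (simp add: f_poly_eq)
  consider "p dvd \<alpha> + 8" | "p dvd \<alpha> - 8" | "p = 3" "3 dvd \<alpha>" | "\<not> p dvd 9 * (\<alpha>\<^sup>2 - 64)"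
  proof (cases "p dvd 9 * (\<alpha>\<^sup>2 - 64)")
    case True
    have "9 * (\<alpha>\<^sup>2 - 64) = 3 * 3 * ((\<alpha> + 8) * (\<alpha> - 8))" by (simp add: algebra_simps power2_eq_square)
    hence "p dvd 3 \<or> p dvd \<alpha> + 8 \<or> p dvd \<alpha> - 8" using True p by (metis prime_dvd_mult_iff)
    moreover have "p = 3" if "p dvd 3"
      using that p int_dvd_3_cases[of p] prime_gt_1_int[OF p] by auto
    \<comment> \<open>For \<open>p = 3\<close> not dividing \<alpha>, one of the triple-root cases
      applies, because 8 is -1 modulo 3.\<close>
    moreover have "3 dvd \<alpha> \<or> 3 dvd \<alpha> + 8 \<or> 3 dvd \<alpha> - 8" by presburger
    ultimately show thesis using that by blast
  qed (use that in blast)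
  thus ?thesis
  proof cases
    case 1
    thus ?thesis using f_poly_prime_dvd_at_triple_root[OF gen, of 1] sf(2) p x deg by simp
  next
    case 2
    thus ?thesis using f_poly_prime_dvd_at_triple_root[OF gen, of "-1"] sf(1) p x deg by simp
  next
    case 3
    then obtain a where a: "\<alpha> = 3 * a" by blast
    show ?thesis unfolding 3(1)
    proof (rule prime_dvd_linear_factor)
      show "f_poly \<alpha> = [:-0, 1:] ^ 4 * 1 - [:3:] * [:1, a, 2:]" unfolding a by (rule f_poly_expansion_0)
      show "of_int 3 * x = ipoly (1 * g + [:3:] * 0) \<theta>" using x(2) 3 by simp
    qed (use x(1) deg in simp_all)
  next
    case 4
    show ?thesis by (rule prime_dvd_unramified[OF p 4 f_poly_bezout x]) (simp add: deg deg_f)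
  qed
qed

theorem theorem1p1:
  fixes \<alpha> :: int
  assumes "squarefree (\<alpha> - 8)" and "squarefree (\<alpha> + 8)"
  shows "irreducible (map_poly of_int (f_poly \<alpha>) :: rat poly) \<and>
    (\<forall>\<theta> :: 'a :: field_char_0. poly (map_poly of_int (f_poly \<alpha>)) \<theta> = 0 \<longrightarrow>
       ring_of_integers (rat_adjoin \<theta>) = int_adjoin \<theta> \<and>
       quartic_field (rat_adjoin \<theta>) \<and> monogenic (rat_adjoin \<theta>))"
proof (intro conjI allI impI)
  \<comment> \<open>The values 8 and -8 are exactly those at which the remainder term
    \<open>(\<alpha> + 8 e) T\<close> vanishes for some sign \<open>e\<close>, so that
    \<open>f\<close> splits into linear factors.\<close>
  have "\<not> squarefree (0 :: int)" by (auto simp: squarefree_int_iff intro: exI[of _ 2])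
  hence "\<alpha> \<noteq> 8" "\<alpha> \<noteq> -8" using assms by auto
  thus irr: "irreducible (map_poly of_int (f_poly \<alpha>) :: rat poly)" by (rule irreducible_f_poly)
  fix \<theta> :: 'a assume root: "poly (map_poly of_int (f_poly \<alpha>)) \<theta> = 0"
  have deg: "degree (f_poly \<alpha>) = 4" by (simp add: f_poly_eq)
  interpret primitive_element "f_poly \<alpha>" \<theta>
    by unfold_locales (use irr root in \<open>simp_all add: f_poly_eq\<close>)
  show ring: "ring_of_integers (rat_adjoin \<theta>) = int_adjoin \<theta>"
    using f_poly_prime_dvd[OF primitive_element_axioms assms] deg
    by (intro ring_of_integers_eq_int_adjoin) simp
  show "quartic_field (rat_adjoin \<theta>)"
    by (simp add: quartic_field_def is_subfield_rat_adjoin rat_degree_rat_adjoin deg)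
  show "monogenic (rat_adjoin \<theta>)" using ring by (auto simp: monogenic_def)
qed

end
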